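(* Let $u>0$ and $p\in(1,2]$ be constants and assume that the reward of each arm satisfies $\mathbb E[|X_n(1)|^p]\le u$, $1\le n\le N$. Let $a=4^{\frac{p}{1-p}}u^{\frac{1}{1-p}}$. Choose a constant $\delta\in(0,\Delta_2/2)$ and a constant $w>\frac{1}{a\,\delta^{p/(p-1)}}$. Construct the exploration sequence as follows: for each $t>1$, $t$ is included in $\mathcal A(t)$ if and only if $|\mathcal A(t-1)|<N\lceil w\log t\rceil$. At an exploration time $t$ play arm $|\mathcal A(t)|\oslash N$. At an exploitation time $t$ (i.e. $t\notin\mathcal A(t)$), play the arm with the largest truncated sample mean $$\widehat\theta_n(\tau_n(t),\epsilon_n(t))=\frac{1}{\tau_n(t)}\sum_{k=1}^{\tau_n(t)}X_{n,k}\,\mathbf 1\left\{|X_{n,k}|\le\left(\frac{uk}{\log(\epsilon_n(t)^{-1})}\right)^{1/p}\right\},$$ where $X_{n,k}$ denotes the $k$th observation of arm $n$ during the exploration sequence, $\tau_n(t)$ is the total number of such observations up to time $t$, and $$\epsilon_n(t)=\exp\left(-a\,\delta^{\frac{p}{p-1}}\tau_n(t)\right).$$ Then the resulting policy $\pi^*$ has regret, for all $T\ge1$, $$R_T^{\pi^*}(\mathcal F)\le\sum_{n=2}^N\lceil w\log T\rceil\,\Delta_n+2N\Delta_N\left(1+\frac{1}{a\,\delta^{p/(p-1)}w-1}\right).$$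
   Context: Bandit model: there are $N\ge2$ independent arms. Playing arm $n$ at time $t\in\{1,2,\dots\}$ yields a reward $X_n(t)$; for each $n$ the rewards $X_n(1),X_n(2),\dots$ are i.i.d. with unknown distribution $f_n$ and finite mean $\theta_n=\mathbb E[X_n(t)]$. Write $\mathcal F=(f_1,\dots,f_N)$. Let $\sigma$ be a permutation of $\{1,\dots,N\}$ with $\theta_{\sigma(1)}\ge\cdots\ge\theta_{\sigma(N)}$, and $\Delta_n=\theta_{\sigma(1)}-\theta_{\sigma(n)}$. At each time a single player plays one arm, chosen by a policy $\pi$ from past observations and decisions. The regret is $R_T^\pi(\mathcal F)=T\theta_{\sigma(1)}-\mathbb E_\pi[\sum_{t=1}^T X_\pi(t)]$, where $X_\pi(t)$ is the reward obtained at time $t$ under $\pi$. $\mathcal A(t)\subseteq\{1,\dots,t\}$ denotes the (deterministic) set of exploration times up to and including $t$, so $\mathcal A(t)$ equals $\mathcal A(t-1)$ or $\mathcal A(t-1)\cup\{t\}$, with $\mathcal A(0)=\mathcal A(1)=\emptyset$; times $t\notin\mathcal A(t)$ are exploitation times. For positive integers $k,l$, $k\oslash l=((k-1)\bmod l)+1$. The truncated sample mean is arbitrary if $\tau_n(t)=0$, and ties are broken arbitrarily. $\log$ is the natural logarithm. *)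

theory Defs
  imports "HOL-Probability.Probability" "HOL-Combinatorics.Permutations"
begin

(* Arms are numbered 1..N and times 1, 2, ...; X n t is the reward that arm n yields at time t. *)

definition arm_mean :: "'w measure \<Rightarrow> (nat \<Rightarrow> nat \<Rightarrow> 'w \<Rightarrow> real) \<Rightarrow> nat \<Rightarrow> real" where
  "arm_mean M X n = (\<integral>\<omega>. X n 1 \<omega> \<partial>M)"

definition gap :: "'w measure \<Rightarrow> (nat \<Rightarrow> nat \<Rightarrow> 'w \<Rightarrow> real) \<Rightarrow> (nat \<Rightarrow> nat) \<Rightarrow> nat \<Rightarrow> real" where
  "gap M X \<sigma> n = arm_mean M X (\<sigma> 1) - arm_mean M X (\<sigma> n)"

(* A history before time t assigns to each s in {1..<t} the pair (arm played, reward obtained). *)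

type_synonym history = "nat \<Rightarrow> nat \<times> real"
type_synonym policy = "nat \<Rightarrow> history \<Rightarrow> nat"

definition history_space :: "nat \<Rightarrow> nat \<Rightarrow> history measure" where
  "history_space N t = (\<Pi>\<^sub>M s\<in>{1..<t}. count_space {1..N} \<Otimes>\<^sub>M (borel :: real measure))"

definition is_policy :: "nat \<Rightarrow> policy \<Rightarrow> bool" where
  "is_policy N \<pi> \<longleftrightarrow>
     (\<forall>t\<ge>1. \<pi> t \<in> measurable (history_space N t) (count_space {1..N}))"

lemma restrict_cong_less [fundef_cong]:
  assumes "I = J" "\<And>i. i \<in> J \<Longrightarrow> f i = g i"
  shows "restrict f I = restrict g J"
  using assms by (auto simp: restrict_def)

(* Arm played at time t when the rewards are x n s. *)
function played :: "policy \<Rightarrow> (nat \<Rightarrow> nat \<Rightarrow> real) \<Rightarrow> nat \<Rightarrow> nat" where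
  "played \<pi> x t = \<pi> t (\<lambda>s\<in>{1..<t}. (played \<pi> x s, x (played \<pi> x s) s))"
  by pat_completeness auto
termination by (relation "Wellfounded.measure (\<lambda>(\<pi>, x, t). t)") auto

declare played.simps [simp del]

definition regret ::
  "'w measure \<Rightarrow> (nat \<Rightarrow> nat \<Rightarrow> 'w \<Rightarrow> real) \<Rightarrow> (nat \<Rightarrow> nat) \<Rightarrow> policy \<Rightarrow> nat \<Rightarrow> real" where
  "regret M X \<sigma> \<pi> T = real T * arm_mean M X (\<sigma> 1)
     - (\<integral>\<omega>. (\<Sum>t=1..T. X (played \<pi> (\<lambda>n s. X n s \<omega>) t) t \<omega>) \<partial>M)"

definition oslash :: "nat \<Rightarrow> nat \<Rightarrow> nat"  (infixl "\<oslash>" 70) where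
  "k \<oslash> l = (k - 1) mod l + 1"

(* The set of exploration times up to and including t. *)
fun explore :: "nat \<Rightarrow> real \<Rightarrow> nat \<Rightarrow> nat set" where
  "explore N w 0 = {}"
| "explore N w (Suc t) =
     (if Suc t > 1 \<and> int (card (explore N w t)) < int N * \<lceil>w * ln (real (Suc t))\<rceil>
      then insert (Suc t) (explore N w t) else explore N w t)"

(* The exploration times up to t at which arm n was played according to the history h;
   used only at exploitation times t, where explore N w t is contained in {1..<t}. *)
definition obs_times :: "nat \<Rightarrow> real \<Rightarrow> nat \<Rightarrow> history \<Rightarrow> nat \<Rightarrow> nat set" where
  "obs_times N w t h n = {s \<in> explore N w t. fst (h s) = n}"

definition obs_count :: "nat \<Rightarrow> real \<Rightarrow> nat \<Rightarrow> history \<Rightarrow> nat \<Rightarrow> nat" where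
  "obs_count N w t h n = card (obs_times N w t h n)"

(* The k-th observation X_{n,k}, for k = 1, ..., obs_count N w t h n. *)
definition obs :: "nat \<Rightarrow> real \<Rightarrow> nat \<Rightarrow> history \<Rightarrow> nat \<Rightarrow> nat \<Rightarrow> real" where
  "obs N w t h n k = snd (h (sorted_list_of_set (obs_times N w t h n) ! (k - 1)))"

definition a_const :: "real \<Rightarrow> real \<Rightarrow> real" where
  "a_const p u = 4 powr (p / (1 - p)) * u powr (1 / (1 - p))"

definition eps ::
  "real \<Rightarrow> real \<Rightarrow> real \<Rightarrow> nat \<Rightarrow> real" where
  "eps p u \<delta> \<tau> = exp (- a_const p u * \<delta> powr (p / (p - 1)) * real \<tau>)"

(* Meaningful for tau > 0 only; x k is the k-th observation. *)
definition trunc_mean :: "real \<Rightarrow> real \<Rightarrow> (nat \<Rightarrow> real) \<Rightarrow> nat \<Rightarrow> real \<Rightarrow> real" where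
  "trunc_mean p u x \<tau> \<epsilon> = 1 / real \<tau> *
     (\<Sum>k=1..\<tau>. x k * of_bool (\<bar>x k\<bar> \<le> (u * real k / ln (inverse \<epsilon>)) powr (1 / p)))"

(* The index v n of an arm without observations is arbitrary, and so is the choice among
   the maximisers of v. *)
definition dsee_policy ::
  "nat \<Rightarrow> real \<Rightarrow> real \<Rightarrow> real \<Rightarrow> real \<Rightarrow> policy \<Rightarrow> bool" where
  "dsee_policy N p u \<delta> w \<pi> \<longleftrightarrow> is_policy N \<pi> \<and>
     (\<forall>t\<ge>1. \<forall>h \<in> space (history_space N t).
        if t \<in> explore N w t then \<pi> t h = card (explore N w t) \<oslash> N
        else (\<exists>v. (\<forall>n\<in>{1..N}. obs_count N w t h n > 0 \<longrightarrow>
                      v n = trunc_mean p u (obs N w t h n) (obs_count N w t h n)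
                              (eps p u \<delta> (obs_count N w t h n)))
                 \<and> is_arg_max v (\<lambda>n. n \<in> {1..N}) (\<pi> t h)))"

end

theory Submission imports Defs begin

text \<open>
  Exploration is round robin, so at an exploitation time \<open>t > 1\<close> every arm has at least
  \<open>w log t\<close> observations, made at times that do not depend on the rewards. Truncated observations
  are bounded by some \<open>B\<close>, and a Chernoff bound with parameter \<open>1 / B\<close>, based on
  \<open>exp x \<le> 1 + x + x\<^sup>2\<close> for \<open>\<bar>x\<bar> \<le> 1\<close>, shows that the truncated mean of an arm is off by \<open>\<delta>\<close>
  or more with probability at most \<open>2 \<epsilon>\<close>, where \<open>\<epsilon> \<le> exp (- c w log t)\<close> and
  \<open>c = a * (\<delta> powr (p / (p - 1)))\<close>. If no arm is off, the best arm is played because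
  \<open>2 \<delta>\<close> is smaller than all positive gaps. Since \<open>c w > 1\<close>, the failure probabilities are summable over \<open>t\<close>.
  Exploration itself plays each arm at most \<open>\<lceil>w log T\<rceil>\<close> times up to time \<open>T\<close>.
\<close>

section \<open>Concentration of the truncated mean\<close>

text \<open>For negative \<open>x = - y\<close> the claim amounts to
  \<open>1 \<le> (1 - y + y\<^sup>2) * exp y\<close>. Replacing \<open>exp y\<close> by its
  quadratic Taylor polynomial leaves a product whose linear term cancels and whose other
  coefficients are nonnegative.\<close>

lemma exp_le_quadratic:
  fixes x :: real
  assumes "\<bar>x\<bar> \<le> 1"
  shows "exp x \<le> 1 + x + x\<^sup>2"
proof (cases "x \<ge> 0")
  case True
  then show ?thesis using assms by (intro exp_bound) auto
next
  case False
  define y where "y = - x"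
  have y: "0 \<le> y" "y \<le> 1" using False assms by (auto simp: y_def)
  have "1 - y + y\<^sup>2 = (y - 1 / 2)\<^sup>2 + 3 / 4"
    by (simp add: power2_eq_square field_simps)
  then have pos: "1 - y + y\<^sup>2 > 0"
    by (simp add: add_nonneg_pos)
  have "1 \<le> (1 - y + y\<^sup>2) * (1 + y + y\<^sup>2 / 2)"
  proof -
    have "(1 - y + y\<^sup>2) * (1 + y + y\<^sup>2 / 2) = 1 + y\<^sup>2 / 2 + y ^ 3 / 2 + y ^ 4 / 2"
      by (simp add: field_simps power2_eq_square power3_eq_cube power4_eq_xxxx)
    then show ?thesis using y by simp
  qed
  also have "\<dots> \<le> (1 - y + y\<^sup>2) * exp y"
    using exp_lower_Taylor_quadratic[OF y(1)] pos by (intro mult_left_mono) auto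
  finally have "exp (- y) \<le> 1 - y + y\<^sup>2"
    by (simp add: exp_minus field_simps)
  then show ?thesis by (simp add: y_def)
qed

text \<open>The quadratic bound is applied to the uncentred \<open>Y / B\<close>, which stays in
  \<open>[-1, 1]\<close>, whereas the centred variable need not. The mean is split off as the factor
  \<open>exp (- m / B)\<close>, so the second moment appears in place of the variance.\<close>

lemma (in prob_space) expectation_exp_centred_le:
  fixes Y :: "'a \<Rightarrow> real"
  assumes Y[measurable]: "random_variable borel Y"
    and bound: "\<And>\<omega>. \<bar>Y \<omega>\<bar> \<le> B" and B: "B > 0"
  shows "integrable M (\<lambda>\<omega>. exp ((Y \<omega> - expectation Y) / B))"
    and "expectation (\<lambda>\<omega>. exp ((Y \<omega> - expectation Y) / B))
           \<le> exp (expectation (\<lambda>\<omega>. (Y \<omega>)\<^sup>2) / B\<^sup>2)"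
proof -
  define m where "m = expectation Y"
  have intY: "integrable M Y"
    using bound by (intro integrable_const_bound[of _ B]) auto
  have intY2: "integrable M (\<lambda>\<omega>. (Y \<omega>)\<^sup>2)"
    using bound B by (intro integrable_const_bound[of _ "B\<^sup>2"])
      (auto simp: abs_le_square_iff[symmetric])
  have "\<bar>exp ((Y \<omega> - m) / B)\<bar> \<le> exp ((B - m) / B)" for \<omega>
    using bound[of \<omega>] B by (auto intro!: divide_right_mono)
  then show int: "integrable M (\<lambda>\<omega>. exp ((Y \<omega> - expectation Y) / B))"
    by (intro integrable_const_bound[of _ "exp ((B - m) / B)"]) (auto simp: m_def)
  have "expectation (\<lambda>\<omega>. exp ((Y \<omega> - expectation Y) / B))
      \<le> expectation (\<lambda>\<omega>. exp (- m / B) * (1 + Y \<omega> / B + (Y \<omega>)\<^sup>2 / B\<^sup>2))"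
  proof (intro integral_mono int)
    show "integrable M (\<lambda>\<omega>. exp (- m / B) * (1 + Y \<omega> / B + (Y \<omega>)\<^sup>2 / B\<^sup>2))"
      using intY intY2 by auto
    fix \<omega>
    have "exp (Y \<omega> / B) \<le> 1 + Y \<omega> / B + (Y \<omega> / B)\<^sup>2"
      using bound[of \<omega>] B by (intro exp_le_quadratic) auto
    moreover have "(Y \<omega> - expectation Y) / B = - m / B + Y \<omega> / B"
      by (simp add: m_def diff_divide_distrib)
    ultimately show "exp ((Y \<omega> - expectation Y) / B)
        \<le> exp (- m / B) * (1 + Y \<omega> / B + (Y \<omega>)\<^sup>2 / B\<^sup>2)"
      by (simp only: exp_add power_divide mult_left_mono exp_ge_zero)
  qed
  also have "\<dots> = exp (- m / B) * (1 + (m / B + expectation (\<lambda>\<omega>. (Y \<omega>)\<^sup>2) / B\<^sup>2))"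
    using intY intY2 by (simp add: m_def prob_space add.assoc)
  \<comment> \<open>\<open>1 + x \<le> exp x\<close> puts the linear term back into the exponent,
    where it cancels the factor \<open>exp (- m / B)\<close>.\<close>
  also have "\<dots> \<le> exp (- m / B) * exp (m / B + expectation (\<lambda>\<omega>. (Y \<omega>)\<^sup>2) / B\<^sup>2)"
    by (intro mult_left_mono exp_ge_add_one_self) auto
  also have "\<dots> = exp (expectation (\<lambda>\<omega>. (Y \<omega>)\<^sup>2) / B\<^sup>2)"
    by (simp flip: exp_add)
  finally show "expectation (\<lambda>\<omega>. exp ((Y \<omega> - expectation Y) / B))
           \<le> exp (expectation (\<lambda>\<omega>. (Y \<omega>)\<^sup>2) / B\<^sup>2)" .
qed

text \<open>Chernoff's inequality with the fixed parameter \<open>1 / B\<close>; by independence the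
  moment generating function factors into the single ones bounded before.\<close>

lemma (in prob_space) bounded_sum_upper_tail:
  fixes Y :: "'i \<Rightarrow> 'a \<Rightarrow> real"
  assumes fin: "finite I" and indep: "indep_vars (\<lambda>_. borel) Y I"
    and bound: "\<And>i \<omega>. i \<in> I \<Longrightarrow> \<bar>Y i \<omega>\<bar> \<le> B" and B: "B > 0"
  shows "prob {\<omega> \<in> space M. (\<Sum>i\<in>I. Y i \<omega> - expectation (Y i)) \<ge> x}
      \<le> exp (- x / B + (\<Sum>i\<in>I. expectation (\<lambda>\<omega>. (Y i \<omega>)\<^sup>2)) / B\<^sup>2)"
proof -
  define D where "D = (\<lambda>i \<omega>. exp ((Y i \<omega> - expectation (Y i)) / B))"
  have rv: "random_variable borel (Y i)" if "i \<in> I" for i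
    using indep that by (auto simp: indep_vars_def)
  have indepD: "indep_vars (\<lambda>_. borel) D I"
    unfolding D_def by (rule indep_vars_compose2[OF indep]) auto
  have intD: "integrable M (D i)" if "i \<in> I" for i
    unfolding D_def using that bound B by (intro expectation_exp_centred_le rv) auto
  have prodD: "(\<lambda>\<omega>. exp (1 / B * (\<Sum>i\<in>I. Y i \<omega> - expectation (Y i)))) = (\<lambda>\<omega>. \<Prod>i\<in>I. D i \<omega>)"
    using fin by (simp add: D_def exp_sum sum_distrib_left)
  have "prob {\<omega> \<in> space M. (\<Sum>i\<in>I. Y i \<omega> - expectation (Y i)) \<ge> x}
      \<le> exp (- (1 / B) * x) *
        (\<integral>\<omega>\<in>space M. exp (1 / B * (\<Sum>i\<in>I. Y i \<omega> - expectation (Y i))) \<partial>M)"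
  proof (intro Chernoff_ineq_ge)
    have "integrable M (\<lambda>\<omega>. \<Prod>i\<in>I. D i \<omega>)"
      by (intro indep_vars_integrable fin indepD intD)
    then show "set_integrable M (space M)
        (\<lambda>\<omega>. exp (1 / B * (\<Sum>i\<in>I. Y i \<omega> - expectation (Y i))))"
      unfolding prodD set_integrable_def by (intro integrable_mult_indicator) auto
  qed (use B in auto)
  also have "(\<integral>\<omega>\<in>space M. exp (1 / B * (\<Sum>i\<in>I. Y i \<omega> - expectation (Y i))) \<partial>M)
      = expectation (\<lambda>\<omega>. \<Prod>i\<in>I. D i \<omega>)"
    unfolding prodD by (subst set_integral_space) (auto intro: indep_vars_integrable fin indepD intD)
  also have "\<dots> = (\<Prod>i\<in>I. expectation (D i))"
    by (intro indep_vars_lebesgue_integral fin indepD intD)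
  also have "exp (- (1 / B) * x) * \<dots>
      \<le> exp (- (1 / B) * x) * (\<Prod>i\<in>I. exp (expectation (\<lambda>\<omega>. (Y i \<omega>)\<^sup>2) / B\<^sup>2))"
    unfolding D_def using bound B
    by (intro mult_left_mono prod_mono conjI expectation_exp_centred_le integral_nonneg_AE rv) auto
  also have "\<dots> = exp (- x / B + (\<Sum>i\<in>I. expectation (\<lambda>\<omega>. (Y i \<omega>)\<^sup>2)) / B\<^sup>2)"
    unfolding exp_add sum_divide_distrib using fin by (simp add: exp_sum)
  finally show ?thesis .
qed

section \<open>Bias and second moment of a truncated variable\<close>

text \<open>Only the part with \<open>\<bar>Z\<bar> > b\<close> is lost, and there
  \<open>\<bar>Z\<bar> = \<bar>Z\<bar> powr p * \<bar>Z\<bar> powr (1 - p)\<close> with a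
  nonpositive second exponent.\<close>

lemma (in prob_space) truncation_bias_le:
  fixes Z :: "'a \<Rightarrow> real"
  assumes int: "integrable M Z" "integrable M (\<lambda>\<omega>. \<bar>Z \<omega>\<bar> powr p)"
    and u: "expectation (\<lambda>\<omega>. \<bar>Z \<omega>\<bar> powr p) \<le> u" and p: "p \<ge> 1" and b: "b > 0"
  shows "\<bar>expectation Z - expectation (\<lambda>\<omega>. Z \<omega> * of_bool (\<bar>Z \<omega>\<bar> \<le> b))\<bar> \<le> u * b powr (1 - p)"
proof -
  have [measurable]: "random_variable borel Z" using int(1) by auto
  have intY: "integrable M (\<lambda>\<omega>. Z \<omega> * of_bool (\<bar>Z \<omega>\<bar> \<le> b))"
    by (rule Bochner_Integration.integrable_bound[OF int(1)]) (auto simp: abs_mult)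
  have pw: "\<bar>z - z * of_bool (\<bar>z\<bar> \<le> b)\<bar> \<le> \<bar>z\<bar> powr p * b powr (1 - p)" for z :: real
  proof (cases "\<bar>z\<bar> \<le> b")
    case False
    have "\<bar>z\<bar> = \<bar>z\<bar> powr p * \<bar>z\<bar> powr (1 - p)"
      using False b by (simp flip: powr_add)
    also have "\<dots> \<le> \<bar>z\<bar> powr p * b powr (1 - p)"
      using False b p by (intro mult_left_mono powr_mono2') auto
    finally show ?thesis using False by simp
  qed auto
  have "\<bar>expectation Z - expectation (\<lambda>\<omega>. Z \<omega> * of_bool (\<bar>Z \<omega>\<bar> \<le> b))\<bar>
      = \<bar>expectation (\<lambda>\<omega>. Z \<omega> - Z \<omega> * of_bool (\<bar>Z \<omega>\<bar> \<le> b))\<bar>"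
    using int(1) intY by simp
  also have "\<dots> \<le> expectation (\<lambda>\<omega>. \<bar>Z \<omega> - Z \<omega> * of_bool (\<bar>Z \<omega>\<bar> \<le> b)\<bar>)"
    by (rule integral_abs_bound)
  also have "\<dots> \<le> expectation (\<lambda>\<omega>. \<bar>Z \<omega>\<bar> powr p * b powr (1 - p))"
    using int intY pw by (intro integral_mono) auto
  also have "\<dots> \<le> u * b powr (1 - p)"
    using u by (simp add: mult_right_mono)
  finally show ?thesis .
qed

text \<open>Where the truncated variable survives, \<open>2 - p\<close> of the two powers of
  \<open>\<bar>Z\<bar>\<close> can be traded for powers of \<open>b\<close>, leaving the p-th
  moment.\<close>

lemma (in prob_space) truncation_second_moment_le:
  fixes Z :: "'a \<Rightarrow> real"
  assumes Z: "random_variable borel Z" and int: "integrable M (\<lambda>\<omega>. \<bar>Z \<omega>\<bar> powr p)"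
    and u: "expectation (\<lambda>\<omega>. \<bar>Z \<omega>\<bar> powr p) \<le> u" and p: "p \<le> 2"
  shows "expectation (\<lambda>\<omega>. (Z \<omega> * of_bool (\<bar>Z \<omega>\<bar> \<le> b))\<^sup>2) \<le> u * b powr (2 - p)"
proof -
  note [measurable] = Z
  have pw: "(z * of_bool (\<bar>z\<bar> \<le> b))\<^sup>2 \<le> \<bar>z\<bar> powr p * b powr (2 - p)" for z :: real
  proof (cases "z \<noteq> 0 \<and> \<bar>z\<bar> \<le> b")
    case True
    have "z\<^sup>2 = \<bar>z\<bar> powr 2"
      using True by (simp)
    also have "\<dots> = \<bar>z\<bar> powr p * \<bar>z\<bar> powr (2 - p)"
      by (simp flip: powr_add)
    also have "\<dots> \<le> \<bar>z\<bar> powr p * b powr (2 - p)"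
      using True p by (intro mult_left_mono powr_mono2) auto
    finally show ?thesis using True by simp
  qed auto
  have "expectation (\<lambda>\<omega>. (Z \<omega> * of_bool (\<bar>Z \<omega>\<bar> \<le> b))\<^sup>2)
      \<le> expectation (\<lambda>\<omega>. \<bar>Z \<omega>\<bar> powr p * b powr (2 - p))"
  proof (rule integral_mono)
    show "integrable M (\<lambda>\<omega>. (Z \<omega> * of_bool (\<bar>Z \<omega>\<bar> \<le> b))\<^sup>2)"
    proof (rule Bochner_Integration.integrable_bound)
      show "integrable M (\<lambda>\<omega>. \<bar>Z \<omega>\<bar> powr p * b powr (2 - p))"
        using int by (rule integrable_mult_left)
      have "norm ((Z \<omega> * of_bool (\<bar>Z \<omega>\<bar> \<le> b))\<^sup>2) \<le> norm (\<bar>Z \<omega>\<bar> powr p * b powr (2 - p))" for \<omega>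
        using pw[of "Z \<omega>"] by (smt (verit) real_norm_def zero_le_power2)
      then show "AE \<omega> in M. norm ((Z \<omega> * of_bool (\<bar>Z \<omega>\<bar> \<le> b))\<^sup>2)
          \<le> norm (\<bar>Z \<omega>\<bar> powr p * b powr (2 - p))"
        by (rule AE_I2)
    qed measurable
  qed (use int pw in auto)
  also have "\<dots> \<le> u * b powr (2 - p)"
    using u by (simp add: mult_right_mono)
  finally show ?thesis .
qed

section \<open>Comparison of power sums with integrals\<close>

text \<open>One step of the comparison of a sum with the integral of \<open>x powr (s - 1)\<close>:
  this function is nonincreasing, so its value at the right endpoint is at most the intermediate
  value. Allowing either sign of \<open>s\<close> serves both sums below.\<close>

lemma powr_le_powr_diff:
  fixes s :: real
  assumes "s \<le> 1" "s \<noteq> 0" "n \<ge> 1"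
  shows "real (Suc n) powr (s - 1) \<le> (real (Suc n) powr s - real n powr s) / s"
proof -
  have "\<exists>z>real n. z < real (Suc n) \<and>
      real (Suc n) powr s - real n powr s = (real (Suc n) - real n) * (s * z powr (s - 1))"
    using assms by (intro MVT2) (auto intro!: derivative_eq_intros)
  then obtain z where z: "real n < z" "z < real (Suc n)"
    and eq: "real (Suc n) powr s - real n powr s = s * z powr (s - 1)"
    by auto
  have "real (Suc n) powr (s - 1) \<le> z powr (s - 1)"
    using z assms by (intro powr_mono2') auto
  then show ?thesis using assms(2) eq by simp
qed

lemma sum_powr_le:
  fixes s :: real
  assumes "0 < s" "s \<le> 1"
  shows "(\<Sum>k=1..n. real k powr (s - 1)) \<le> real n powr s / s"
proof (induction n)
  case (Suc n)
  \<comment> \<open>For \<open>n = 0\<close> the preceding lemma does not apply; the claim is then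
    \<open>1 \<le> 1 / s\<close>, since \<open>0 powr s\<close> is 0.\<close>
  have "real (Suc n) powr (s - 1) \<le> (real (Suc n) powr s - real n powr s) / s"
    using assms powr_le_powr_diff[of s n] by (cases "n = 0") auto
  then show ?case using Suc by (simp add: diff_divide_distrib)
qed simp

lemma sum_powr_neg_le:
  fixes q :: real
  assumes "q > 1" "n \<ge> 1"
  shows "(\<Sum>k=1..n. real k powr - q) \<le> 1 + 1 / (q - 1)"
proof -
  \<comment> \<open>The induction needs the remainder \<open>real n powr (1 - q)\<close>, which
    makes the differences telescope; it is dropped afterwards.\<close>
  have "(\<Sum>k=1..n. real k powr - q) \<le> 1 + (1 - real n powr (1 - q)) / (q - 1)"
    using assms(2)
  proof (induction n rule: nat_induct_at_least)
    case (Suc n)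
    have "real (Suc n) powr - q \<le> (real n powr (1 - q) - real (Suc n) powr (1 - q)) / (q - 1)"
      using powr_le_powr_diff[of "1 - q" n] assms(1) Suc.hyps
      by (simp add: field_simps)
    then show ?case using Suc.IH by (simp add: diff_divide_distrib)
  qed simp
  also have "\<dots> \<le> 1 + 1 / (q - 1)"
    using assms by (simp add: divide_right_mono)
  finally show ?thesis .
qed

section \<open>Deviation of the truncated mean\<close>

text \<open>Of the four units of deviation, the truncation bias uses at most \<open>p \<le> 2\<close> and the fluctuation
  of the truncated sum the other two.\<close>

lemma (in prob_space) trunc_mean_upper_tail:
  fixes Z :: "nat \<Rightarrow> 'a \<Rightarrow> real"
  assumes indep: "indep_vars (\<lambda>_. borel) Z {1..\<tau>}"
    and int: "\<And>k. k \<in> {1..\<tau>} \<Longrightarrow> integrable M (Z k)"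
      "\<And>k. k \<in> {1..\<tau>} \<Longrightarrow> integrable M (\<lambda>\<omega>. \<bar>Z k \<omega>\<bar> powr p)"
    and mean: "\<And>k. k \<in> {1..\<tau>} \<Longrightarrow> expectation (Z k) = \<theta>"
    and moment: "\<And>k. k \<in> {1..\<tau>} \<Longrightarrow> expectation (\<lambda>\<omega>. \<bar>Z k \<omega>\<bar> powr p) \<le> u"
    and u: "u > 0" and p: "1 < p" "p \<le> 2" and \<tau>: "\<tau> > 0" and \<epsilon>: "0 < \<epsilon>" "\<epsilon> < 1"
  shows "prob {\<omega> \<in> space M. trunc_mean p u (\<lambda>k. Z k \<omega>) \<tau> \<epsilon> - \<theta>
           \<ge> 4 * u powr (1 / p) * (ln (inverse \<epsilon>) / real \<tau>) powr (1 - 1 / p)} \<le> \<epsilon>"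
proof -
  define L where "L = ln (inverse \<epsilon>)"
  have L: "L > 0" using \<epsilon> by (simp add: L_def ln_inverse)
  \<comment> \<open>The truncation levels grow with \<open>k\<close>, so the last one,
    \<open>B\<close>, bounds all truncated observations. \<open>D\<close> is one of the four units
    of deviation.\<close>
  define b where "b = (\<lambda>k::nat. (u * real k / L) powr (1 / p))"
  define B where "B = b \<tau>"
  define D where "D = u powr (1 / p) * (L / real \<tau>) powr (1 - 1 / p)"
  define Y where "Y = (\<lambda>k \<omega>. Z k \<omega> * of_bool (\<bar>Z k \<omega>\<bar> \<le> b k))"
  have b0: "b k > 0" if "k \<in> {1..\<tau>}" for k using that u L by (simp add: b_def)
  have B: "B > 0" using b0 \<tau> by (simp add: B_def)
  have bB: "b k \<le> B" if "k \<in> {1..\<tau>}" for k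
    using that u L p unfolding B_def b_def
    by (intro powr_mono2 divide_right_mono mult_left_mono) auto
  have rv: "random_variable borel (Z k)" if "k \<in> {1..\<tau>}" for k
    using int(1)[OF that] by auto
  have indepY: "indep_vars (\<lambda>_. borel) Y {1..\<tau>}"
    unfolding Y_def by (rule indep_vars_compose2[OF indep]) auto
  have Y_le: "\<bar>Y k \<omega>\<bar> \<le> B" if "k \<in> {1..\<tau>}" for k \<omega>
    using bB[OF that] B by (auto simp: Y_def)
  \<comment> \<open>One unit of deviation, on the scale of the sum, is \<open>B * L\<close>; with
    Chernoff parameter \<open>1 / B\<close> it contributes exactly \<open>L\<close> to the
    exponent.\<close>
  have BL: "B * L = real \<tau> * D"
  proof -
    have "B * L = u powr (1 / p) * real \<tau> powr (1 / p) * (L powr 1 / L powr (1 / p))"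
      using u \<tau> L by (simp add: B_def b_def powr_mult powr_divide)
    also have "real \<tau> powr (1 / p) = real \<tau> powr 1 / real \<tau> powr (1 - 1 / p)"
      unfolding powr_diff[symmetric] by simp
    also have "L powr 1 / L powr (1 / p) = L powr (1 - 1 / p)"
      by (simp only: powr_diff)
    also have "u powr (1 / p) * (real \<tau> powr 1 / real \<tau> powr (1 - 1 / p)) * L powr (1 - 1 / p)
        = real \<tau> * D"
      using \<tau> L by (simp add: D_def powr_divide)
    finally show ?thesis .
  qed
  have Bp: "B powr p = u * real \<tau> / L"
    using u \<tau> L p by (simp add: B_def b_def powr_powr)
  \<comment> \<open>The quadratic term costs at most \<open>L\<close>: the sum of second moments is
    at most \<open>\<tau> * u * B powr (2 - p)\<close>, and
    \<open>B powr p = u * \<tau> / L\<close>.\<close>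
  have second: "(\<Sum>k\<in>{1..\<tau>}. expectation (\<lambda>\<omega>. (Y k \<omega>)\<^sup>2)) / B\<^sup>2 \<le> L"
  proof -
    have "(\<Sum>k\<in>{1..\<tau>}. expectation (\<lambda>\<omega>. (Y k \<omega>)\<^sup>2)) \<le> (\<Sum>k\<in>{1..\<tau>}. u * B powr (2 - p))"
    proof (rule sum_mono)
      fix k assume k: "k \<in> {1..\<tau>}"
      have "expectation (\<lambda>\<omega>. (Y k \<omega>)\<^sup>2) \<le> u * b k powr (2 - p)"
        unfolding Y_def using k p by (intro truncation_second_moment_le rv int moment) auto
      also have "\<dots> \<le> u * B powr (2 - p)"
        using u p bB[OF k] b0[OF k] by (intro mult_left_mono powr_mono2) auto
      finally show "expectation (\<lambda>\<omega>. (Y k \<omega>)\<^sup>2) \<le> u * B powr (2 - p)" .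
    qed
    also have "\<dots> = real \<tau> * u * (B\<^sup>2 / B powr p)"
      using B by (simp add: powr_diff)
    also have "\<dots> = L * B\<^sup>2"
      using u L \<tau> by (simp add: Bp)
    finally show ?thesis using B by (simp add: divide_le_eq)
  qed
  have bias: "(\<Sum>k=1..\<tau>. expectation (Y k)) \<le> real \<tau> * \<theta> + 2 * (real \<tau> * D)"
  proof -
    have "expectation (Y k) \<le> \<theta> + B * L / real \<tau> powr (1 / p) * real k powr (1 / p - 1)"
      if k: "k \<in> {1..\<tau>}" for k
    proof -
      have "\<bar>expectation (Z k) - expectation (Y k)\<bar> \<le> u * b k powr (1 - p)"
        unfolding Y_def using k p by (intro truncation_bias_le int moment b0) auto
      also have "b k powr (1 - p) = (u * real k / L) powr (1 / p - 1)"
        using u L k p by (simp add: b_def powr_powr diff_divide_distrib)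
      \<comment> \<open>Separating the factor that does not depend on \<open>k\<close> leaves the
        sum of \<open>k powr (1 / p - 1)\<close>, which is at most
        \<open>p * \<tau> powr (1 / p)\<close>.\<close>
      also have "u * \<dots> = B * L / real \<tau> powr (1 / p) * real k powr (1 / p - 1)"
        using u L k \<tau> by (simp add: B_def b_def powr_mult powr_divide powr_diff)
      finally show ?thesis using mean[OF k] by linarith
    qed
    then have "(\<Sum>k=1..\<tau>. expectation (Y k))
        \<le> (\<Sum>k=1..\<tau>. \<theta> + B * L / real \<tau> powr (1 / p) * real k powr (1 / p - 1))"
      by (intro sum_mono) auto
    also have "\<dots> = real \<tau> * \<theta>
        + B * L / real \<tau> powr (1 / p) * (\<Sum>k=1..\<tau>. real k powr (1 / p - 1))"
      by (simp add: sum.distrib sum_distrib_left)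
    also have "\<dots> \<le> real \<tau> * \<theta> + B * L / real \<tau> powr (1 / p) * (real \<tau> powr (1 / p) / (1 / p))"
      using B L p by (intro add_left_mono mult_left_mono sum_powr_le) auto
    also have "\<dots> = real \<tau> * \<theta> + p * (B * L)"
      using \<tau> by simp
    also have "\<dots> \<le> real \<tau> * \<theta> + 2 * (B * L)"
      using p B L by (intro add_left_mono mult_right_mono) auto
    finally show ?thesis unfolding BL .
  qed
  have tm: "trunc_mean p u (\<lambda>k. Z k \<omega>) \<tau> \<epsilon> = (\<Sum>k=1..\<tau>. Y k \<omega>) / real \<tau>" for \<omega>
    by (simp add: trunc_mean_def Y_def b_def L_def)
  have "prob {\<omega> \<in> space M. trunc_mean p u (\<lambda>k. Z k \<omega>) \<tau> \<epsilon> - \<theta> \<ge> 4 * D}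
      \<le> prob {\<omega> \<in> space M. (\<Sum>k\<in>{1..\<tau>}. Y k \<omega> - expectation (Y k)) \<ge> 2 * (B * L)}"
  proof (rule finite_measure_mono)
    show "{\<omega> \<in> space M. trunc_mean p u (\<lambda>k. Z k \<omega>) \<tau> \<epsilon> - \<theta> \<ge> 4 * D}
      \<subseteq> {\<omega> \<in> space M. (\<Sum>k\<in>{1..\<tau>}. Y k \<omega> - expectation (Y k)) \<ge> 2 * (B * L)}"
    proof safe
      fix \<omega> assume "4 * D \<le> trunc_mean p u (\<lambda>k. Z k \<omega>) \<tau> \<epsilon> - \<theta>"
      then have "real \<tau> * \<theta> + 4 * (real \<tau> * D) \<le> (\<Sum>k=1..\<tau>. Y k \<omega>)"
        using \<tau> by (simp add: tm field_simps)
      then show "2 * (B * L) \<le> (\<Sum>k\<in>{1..\<tau>}. Y k \<omega> - expectation (Y k))"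
        using bias unfolding BL sum_subtractf by linarith
    qed
    have [measurable]: "random_variable borel (Y k)" if "k \<in> {1..\<tau>}" for k
      using indepY that by (auto simp: indep_vars_def)
    show "{\<omega> \<in> space M. (\<Sum>k\<in>{1..\<tau>}. Y k \<omega> - expectation (Y k)) \<ge> 2 * (B * L)} \<in> events"
      by measurable
  qed
  also have "\<dots> \<le> exp (- (2 * (B * L)) / B
      + (\<Sum>k\<in>{1..\<tau>}. expectation (\<lambda>\<omega>. (Y k \<omega>)\<^sup>2)) / B\<^sup>2)"
    by (intro bounded_sum_upper_tail indepY Y_le B) auto
  \<comment> \<open>The deviation \<open>2 * (B * L)\<close> contributes \<open>- 2 * L\<close> and
    the second moments at most \<open>L\<close>.\<close>
  also have "\<dots> \<le> exp (- L)"
    using second B by simp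
  also have "\<dots> = \<epsilon>"
    using \<epsilon> by (simp add: L_def ln_inverse)
  finally show ?thesis by (simp add: D_def L_def mult.assoc)
qed

lemma trunc_mean_cong:
  assumes "\<And>k. k \<in> {1..\<tau>} \<Longrightarrow> x k = y k"
  shows "trunc_mean p u x \<tau> \<epsilon> = trunc_mean p u y \<tau> \<epsilon>"
  unfolding trunc_mean_def using assms by (intro arg_cong2[where f = "(*)"] sum.cong) auto

lemma trunc_mean_uminus: "trunc_mean p u (\<lambda>k. - x k) \<tau> \<epsilon> = - trunc_mean p u x \<tau> \<epsilon>"
  by (simp add: trunc_mean_def sum_negf)

text \<open>The truncated mean is odd in the data because the indicator sees absolute values only,
  so the lower tail is the upper tail for \<open>- Z\<close>.\<close>

lemma (in prob_space) trunc_mean_deviation: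
  fixes Z :: "nat \<Rightarrow> 'a \<Rightarrow> real"
  assumes indep: "indep_vars (\<lambda>_. borel) Z {1..\<tau>}"
    and int: "\<And>k. k \<in> {1..\<tau>} \<Longrightarrow> integrable M (Z k)"
      "\<And>k. k \<in> {1..\<tau>} \<Longrightarrow> integrable M (\<lambda>\<omega>. \<bar>Z k \<omega>\<bar> powr p)"
    and mean: "\<And>k. k \<in> {1..\<tau>} \<Longrightarrow> expectation (Z k) = \<theta>"
    and moment: "\<And>k. k \<in> {1..\<tau>} \<Longrightarrow> expectation (\<lambda>\<omega>. \<bar>Z k \<omega>\<bar> powr p) \<le> u"
    and u: "u > 0" and p: "1 < p" "p \<le> 2" and \<tau>: "\<tau> > 0" and \<epsilon>: "0 < \<epsilon>" "\<epsilon> < 1"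
  shows "prob {\<omega> \<in> space M. \<bar>trunc_mean p u (\<lambda>k. Z k \<omega>) \<tau> \<epsilon> - \<theta>\<bar>
           \<ge> 4 * u powr (1 / p) * (ln (inverse \<epsilon>) / real \<tau>) powr (1 - 1 / p)} \<le> 2 * \<epsilon>"
    (is "prob {\<omega> \<in> space M. \<bar>?m \<omega> - \<theta>\<bar> \<ge> ?d} \<le> _")
proof -
  have [measurable]: "random_variable borel (Z k)" if "k \<in> {1..\<tau>}" for k
    using int(1)[OF that] by auto
  have [measurable]: "random_variable borel ?m"
    unfolding trunc_mean_def by measurable
  have eq: "{\<omega> \<in> space M. \<bar>?m \<omega> - \<theta>\<bar> \<ge> ?d} =
      {\<omega> \<in> space M. ?m \<omega> - \<theta> \<ge> ?d}
      \<union> {\<omega> \<in> space M. trunc_mean p u (\<lambda>k. - Z k \<omega>) \<tau> \<epsilon> - (- \<theta>) \<ge> ?d}"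
    unfolding trunc_mean_uminus by auto
  have "prob {\<omega> \<in> space M. \<bar>?m \<omega> - \<theta>\<bar> \<ge> ?d} \<le> prob {\<omega> \<in> space M. ?m \<omega> - \<theta> \<ge> ?d}
      + prob {\<omega> \<in> space M. trunc_mean p u (\<lambda>k. - Z k \<omega>) \<tau> \<epsilon> - (- \<theta>) \<ge> ?d}"
    unfolding eq by (intro measure_Un_le) (simp_all add: trunc_mean_uminus)
  also have "\<dots> \<le> \<epsilon> + \<epsilon>"
  proof (intro add_mono trunc_mean_upper_tail)
    show "indep_vars (\<lambda>_. borel) (\<lambda>k \<omega>. - Z k \<omega>) {1..\<tau>}"
      by (rule indep_vars_compose2[OF indep]) auto
  qed (use assms in auto)
  finally show ?thesis by simp
qed

section \<open>Measurability and independence of the decisions\<close>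

text \<open>Names the argument that the recursion for \<open>played\<close> passes to the policy, so
  that a single decision can be unfolded.\<close>

definition history_of :: "policy \<Rightarrow> (nat \<Rightarrow> nat \<Rightarrow> real) \<Rightarrow> nat \<Rightarrow> history" where
  "history_of \<pi> x t = (\<lambda>s\<in>{1..<t}. (played \<pi> x s, x (played \<pi> x s) s))"

lemma played_eq: "played \<pi> x t = \<pi> t (history_of \<pi> x t)"
  unfolding history_of_def by (rule played.simps)

lemma space_history_space:
  "space (history_space N t) = ({1..<t} \<rightarrow>\<^sub>E {1..N} \<times> UNIV)"
  by (simp add: history_space_def space_PiM space_pair_measure)

text \<open>A policy is constrained only on its history space, so the strong induction has to show
  that all earlier decisions were arms.\<close>

lemma played_in_arms:
  assumes "is_policy N \<pi>" "t \<ge> 1"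
  shows "played \<pi> x t \<in> {1..N}"
  using assms(2)
proof (induction t rule: less_induct)
  case (less t)
  have "history_of \<pi> x t \<in> space (history_space N t)"
    using less.IH unfolding space_history_space history_of_def by (intro restrict_PiE_iff[THEN iffD2]) auto
  then show ?case
    using assms(1) less.prems measurable_space[of "\<pi> t" "history_space N t" "count_space {1..N}"]
    by (auto simp: is_policy_def played_eq[of \<pi> x t])
qed

lemma history_of_in_space:
  assumes "is_policy N \<pi>"
  shows "history_of \<pi> x t \<in> space (history_space N t)"
  using played_in_arms[OF assms] unfolding space_history_space history_of_def
  by (intro restrict_PiE_iff[THEN iffD2]) auto

text \<open>Adaptedness: the decision at \<open>t\<close> becomes a function of the finitely many
  rewards before \<open>t\<close>, as the independence argument requires.\<close>

lemma played_cong: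
  assumes "is_policy N \<pi>" "t \<ge> 1"
    and "\<And>n s. n \<in> {1..N} \<Longrightarrow> s \<in> {1..<t} \<Longrightarrow> x n s = y n s"
  shows "played \<pi> x t = played \<pi> y t"
  using assms(2,3)
proof (induction t rule: less_induct)
  case (less t)
  have eq: "played \<pi> x s = played \<pi> y s" if "s \<in> {1..<t}" for s
    using that by (intro less.IH less.prems) auto
  have "history_of \<pi> x t = history_of \<pi> y t"
    unfolding history_of_def
  proof (rule restrict_ext)
    fix s assume s: "s \<in> {1..<t}"
    then show "(played \<pi> x s, x (played \<pi> x s) s) = (played \<pi> y s, y (played \<pi> y s) s)"
      using eq[OF s] less.prems(2)[OF _ s] played_in_arms[OF assms(1), of s y] by auto
  qed
  then show ?case by (simp only: played_eq)
qed

lemma measurable_played: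
  assumes "is_policy N \<pi>" "t \<ge> 1"
    and "\<And>n s. n \<in> {1..N} \<Longrightarrow> s \<in> {1..<t} \<Longrightarrow> (\<lambda>\<omega>. x \<omega> n s) \<in> borel_measurable M"
  shows "(\<lambda>\<omega>. played \<pi> (x \<omega>) t) \<in> measurable M (count_space {1..N})"
  using assms(2,3)
proof (induction t rule: less_induct)
  case (less t)
  have "(\<lambda>\<omega>. history_of \<pi> (x \<omega>) t) \<in> measurable M (history_space N t)"
    unfolding history_of_def history_space_def
  proof (rule measurable_restrict)
    fix s assume s: "s \<in> {1..<t}"
    have P: "(\<lambda>\<omega>. played \<pi> (x \<omega>) s) \<in> measurable M (count_space {1..N})"
      using s by (intro less.IH less.prems) auto
    \<comment> \<open>The arm index is itself random; it takes countably many values, and for each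
      fixed arm the reward is measurable.\<close>
    moreover have "(\<lambda>\<omega>. x \<omega> (played \<pi> (x \<omega>) s) s) \<in> borel_measurable M"
      by (rule measurable_compose_countable'[OF _ P]) (use s less.prems in auto)
    ultimately show "(\<lambda>\<omega>. (played \<pi> (x \<omega>) s, x \<omega> (played \<pi> (x \<omega>) s) s))
        \<in> measurable M (count_space {1..N} \<Otimes>\<^sub>M borel)"
      by (rule measurable_Pair)
  qed
  moreover have "\<pi> t \<in> measurable (history_space N t) (count_space {1..N})"
    using assms(1) less.prems by (simp add: is_policy_def)
  ultimately show ?case
    unfolding played_eq[of \<pi> _ t] by (rule measurable_compose)
qed

text \<open>The arm played at time \<open>t\<close> depends on the rewards before \<open>t\<close> only, hence it is independent of
  the rewards at time \<open>t\<close>.\<close>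

lemma (in prob_space) reward_of_played_arm:
  fixes X :: "nat \<Rightarrow> nat \<Rightarrow> 'a \<Rightarrow> real"
  assumes indep: "indep_vars (\<lambda>_. borel) (\<lambda>(n, t). X n t) ({1..N} \<times> {1..})"
    and \<pi>: "is_policy N \<pi>" and t: "t \<ge> 1" and n: "n \<in> {1..N}" and int: "integrable M (X n t)"
  shows "integrable M (\<lambda>\<omega>. of_bool (played \<pi> (\<lambda>m s. X m s \<omega>) t = n) * X n t \<omega>)" (is ?I)
    and "expectation (\<lambda>\<omega>. of_bool (played \<pi> (\<lambda>m s. X m s \<omega>) t = n) * X n t \<omega>)
      = prob {\<omega> \<in> space M. played \<pi> (\<lambda>m s. X m s \<omega>) t = n} * expectation (X n t)" (is ?E)
proof -
  \<comment> \<open>\<open>A\<close> holds the coordinates before \<open>t\<close>, hence is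
    disjoint from \<open>{(n, t)}\<close>. \<open>G\<close> is the decision indicator on the product
    space over \<open>A\<close>, and \<open>F\<close> the same indicator on the sample
    space.\<close>
  define A where "A = {1..N} \<times> {1..<t}"
  define G :: "(nat \<times> nat \<Rightarrow> real) \<Rightarrow> real"
    where "G = (\<lambda>y. of_bool (played \<pi> (\<lambda>m s. y (m, s)) t = n))"
  define F where "F = (\<lambda>\<omega>. of_bool (played \<pi> (\<lambda>m s. X m s \<omega>) t = n) :: real)"
  have rv: "random_variable borel (X m s)" if "m \<in> {1..N}" "s \<ge> 1" for m s
    using indep that unfolding indep_vars_def by (auto dest!: bspec[where x="(m, s)"])
  have [measurable]: "(\<lambda>\<omega>. played \<pi> (\<lambda>m s. X m s \<omega>) t) \<in> measurable M (count_space {1..N})"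
    using rv by (intro measurable_played[OF \<pi> t]) auto
  have [measurable]: "(\<lambda>y. played \<pi> (\<lambda>m s. y (m, s)) t)
      \<in> measurable (PiM A (\<lambda>_. borel)) (count_space {1..N})"
    by (intro measurable_played[OF \<pi> t]) (auto simp: A_def intro!: measurable_component_singleton)
  have indepAB: "indep_var
      (PiM A (\<lambda>_. borel)) (\<lambda>\<omega>. restrict (\<lambda>i. (case i of (n, t) \<Rightarrow> X n t) \<omega>) A)
      (PiM {(n, t)} (\<lambda>_. borel)) (\<lambda>\<omega>. restrict (\<lambda>i. (case i of (n, t) \<Rightarrow> X n t) \<omega>) {(n, t)})"
    using t n by (intro indep_var_restrict[OF indep]) (auto simp: A_def)
  have "indep_var borel (G \<circ> (\<lambda>\<omega>. restrict (\<lambda>i. (case i of (n, t) \<Rightarrow> X n t) \<omega>) A))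
      borel ((\<lambda>y. y (n, t)) \<circ> (\<lambda>\<omega>. restrict (\<lambda>i. (case i of (n, t) \<Rightarrow> X n t) \<omega>) {(n, t)}))"
    by (rule indep_var_compose[OF indepAB]) (auto simp: G_def)
  moreover have "G \<circ> (\<lambda>\<omega>. restrict (\<lambda>i. (case i of (n, t) \<Rightarrow> X n t) \<omega>) A) = F"
  proof
    fix \<omega>
    \<comment> \<open>Restriction to \<open>A\<close> alters only rewards that the decision at
      \<open>t\<close> cannot see.\<close>
    have "played \<pi> (\<lambda>m s. restrict (\<lambda>i. (case i of (n, t) \<Rightarrow> X n t) \<omega>) A (m, s)) t
        = played \<pi> (\<lambda>m s. X m s \<omega>) t"
      by (rule played_cong[OF \<pi> t]) (simp add: A_def)
    then show "(G \<circ> (\<lambda>\<omega>. restrict (\<lambda>i. (case i of (n, t) \<Rightarrow> X n t) \<omega>) A)) \<omega> = F \<omega>"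
      by (simp add: G_def F_def)
  qed
  moreover have "(\<lambda>y. y (n, t)) \<circ> (\<lambda>\<omega>. restrict (\<lambda>i. (case i of (n, t) \<Rightarrow> X n t) \<omega>) {(n, t)}) = X n t"
    by (simp add: fun_eq_iff)
  ultimately have FX: "indep_var borel F borel (X n t)" by simp
  have intF: "integrable M F"
    unfolding F_def by (intro integrable_const_bound[of _ 1]) auto
  show ?I
    using indep_var_integrable[OF FX intF int] by (simp add: F_def)
  have "F = (\<lambda>\<omega>. indicator {\<omega>. played \<pi> (\<lambda>m s. X m s \<omega>) t = n} \<omega>)"
    by (auto simp: F_def fun_eq_iff)
  then have "expectation F = prob {\<omega> \<in> space M. played \<pi> (\<lambda>m s. X m s \<omega>) t = n}"
    by (simp add: Int_def conj_commute)
  then show ?E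
    using indep_var_lebesgue_integral[OF FX intF int] by (simp add: F_def)
qed

text \<open>Splitting by the value of the random arm index turns the reward into a finite sum, to
  each term of which the product formula applies.\<close>

lemma (in prob_space) expected_reward:
  fixes X :: "nat \<Rightarrow> nat \<Rightarrow> 'a \<Rightarrow> real"
  assumes indep: "indep_vars (\<lambda>_. borel) (\<lambda>(n, t). X n t) ({1..N} \<times> {1..})"
    and \<pi>: "is_policy N \<pi>" and t: "t \<ge> 1" and int: "\<And>n. n \<in> {1..N} \<Longrightarrow> integrable M (X n t)"
  shows "integrable M (\<lambda>\<omega>. X (played \<pi> (\<lambda>m s. X m s \<omega>) t) t \<omega>)"
    and "expectation (\<lambda>\<omega>. X (played \<pi> (\<lambda>m s. X m s \<omega>) t) t \<omega>)
      = (\<Sum>n=1..N. prob {\<omega> \<in> space M. played \<pi> (\<lambda>m s. X m s \<omega>) t = n} * expectation (X n t))"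
proof -
  note R = reward_of_played_arm[OF indep \<pi> t _ int]
  have eq: "(\<lambda>\<omega>. X (played \<pi> (\<lambda>m s. X m s \<omega>) t) t \<omega>)
      = (\<lambda>\<omega>. \<Sum>n=1..N. of_bool (played \<pi> (\<lambda>m s. X m s \<omega>) t = n) * X n t \<omega>)"
  proof
    fix \<omega>
    have "played \<pi> (\<lambda>m s. X m s \<omega>) t \<in> {1..N}" by (rule played_in_arms[OF \<pi> t])
    then show "X (played \<pi> (\<lambda>m s. X m s \<omega>) t) t \<omega>
        = (\<Sum>n=1..N. of_bool (played \<pi> (\<lambda>m s. X m s \<omega>) t = n) * X n t \<omega>)"
      by (simp add: sum.remove[of "{1..N}" "played \<pi> (\<lambda>m s. X m s \<omega>) t"])
  qed
  show "integrable M (\<lambda>\<omega>. X (played \<pi> (\<lambda>m s. X m s \<omega>) t) t \<omega>)"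
    unfolding eq by (intro Bochner_Integration.integrable_sum R(1))
  show "expectation (\<lambda>\<omega>. X (played \<pi> (\<lambda>m s. X m s \<omega>) t) t \<omega>)
      = (\<Sum>n=1..N. prob {\<omega> \<in> space M. played \<pi> (\<lambda>m s. X m s \<omega>) t = n} * expectation (X n t))"
    unfolding eq using R by (subst Bochner_Integration.integral_sum) auto
qed

section \<open>The exploration sequence\<close>

lemma explore_subset: "explore N w t \<subseteq> {2..t}"
  by (induction t) (auto split: if_splits)

lemma finite_explore [simp]: "finite (explore N w t)"
  using explore_subset by (rule finite_subset) simp

lemma mem_explore_iff: "s \<le> t \<Longrightarrow> s \<in> explore N w t \<longleftrightarrow> s \<in> explore N w s"
proof (induction t)
  case (Suc t)
  then show ?case by (cases "s = Suc t") auto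
qed simp

lemma card_explore_Suc:
  "card (explore N w (Suc t)) =
    (if Suc t \<in> explore N w (Suc t) then Suc (card (explore N w t)) else card (explore N w t))"
  using explore_subset[of N w t] by (auto simp: card_insert_if)

text \<open>The count at an exploration time is its rank among the exploration times, so round-robin
  play can be counted on an initial segment of ranks.\<close>

lemma bij_betw_card_explore:
  "bij_betw (\<lambda>s. card (explore N w s)) (explore N w t) {1..card (explore N w t)}"
proof (induction t)
  case (Suc t)
  show ?case
  proof (cases "Suc t \<in> explore N w (Suc t)")
    case True
    have "explore N w (Suc t) = insert (Suc t) (explore N w t)"
      using True explore_subset[of N w t] by (auto split: if_splits)
    moreover have "{1..card (explore N w (Suc t))} =
        insert (card (explore N w (Suc t))) {1..card (explore N w t)}"
      using True card_explore_Suc[of N w t] by (auto simp del: explore.simps)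
    moreover have "Suc t \<notin> explore N w t" using explore_subset[of N w t] by auto
    moreover have "card (explore N w (Suc t)) \<notin> {1..card (explore N w t)}"
      using True card_explore_Suc[of N w t] by (auto simp del: explore.simps)
    ultimately show ?thesis
      using notIn_Un_bij_betw[OF _ _ Suc.IH, of "Suc t"] by (simp del: explore.simps)
  next
    case False
    then have "explore N w (Suc t) = explore N w t" by (auto split: if_splits)
    then show ?thesis using Suc.IH by (simp del: explore.simps)
  qed
qed (simp add: bij_betw_def)

text \<open>A time is added only while the integer count is strictly below the threshold, so one
  more cannot exceed it; otherwise the threshold does not decrease, as \<open>w \<ge> 0\<close>. At
  time 1 both sides vanish.\<close>

lemma card_explore_le:
  assumes "w \<ge> 0" "t \<ge> 1"
  shows "int (card (explore N w t)) \<le> int N * \<lceil>w * ln (real t)\<rceil>"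
  using assms(2)
proof (induction t rule: nat_induct_at_least)
  case base
  then show ?case by simp
next
  case (Suc t)
  show ?case
  proof (cases "Suc t \<in> explore N w (Suc t)")
    case True
    then have "int (card (explore N w t)) < int N * \<lceil>w * ln (real (Suc t))\<rceil>"
      using explore_subset[of N w t] by (auto split: if_splits)
    then show ?thesis using True by (simp add: card_explore_Suc del: explore.simps)
  next
    case False
    have "int N * \<lceil>w * ln (real t)\<rceil> \<le> int N * \<lceil>w * ln (real (Suc t))\<rceil>"
      using assms(1) Suc.hyps by (intro mult_left_mono ceiling_mono) auto
    with Suc.IH False show ?thesis by (simp add: card_explore_Suc del: explore.simps)
  qed
qed

text \<open>A time after the first stays out only by failing the test, and then the count equals
  that of the preceding time.\<close>

lemma card_explore_ge:
  assumes "t > 1" "t \<notin> explore N w t"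
  shows "int N * \<lceil>w * ln (real t)\<rceil> \<le> int (card (explore N w t))"
  using assms by (cases t) (auto split: if_splits)

section \<open>Round-robin counts of each arm\<close>

text \<open>Each of the \<open>C\<close> blocks of \<open>N\<close> consecutive ranks contains arm
  \<open>n\<close> once: block \<open>i\<close> at rank \<open>i * N + n\<close>, recovered from a
  rank \<open>j\<close> as \<open>(j - 1) div N\<close>.\<close>

lemma card_oslash:
  assumes "n \<in> {1..N}"
  shows "card {j \<in> {1..N * C}. j \<oslash> N = n} = C"
proof -
  have "bij_betw (\<lambda>i. i * N + n) {..<C} {j \<in> {1..N * C}. j \<oslash> N = n}"
  proof (rule bij_betw_byWitness[where f' = "\<lambda>j. (j - 1) div N"])
    show "\<forall>i\<in>{..<C}. (i * N + n - 1) div N = i"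
    proof
      fix i
      have "i * N + n - 1 = (n - 1) + i * N" using assms by auto
      moreover have "((n - 1) + i * N) div N = i" using assms by (subst div_mult_self1) auto
      ultimately show "(i * N + n - 1) div N = i" by (simp only:)
    qed
    show "\<forall>j\<in>{j \<in> {1..N * C}. j \<oslash> N = n}. (j - 1) div N * N + n = j"
    proof
      fix j assume j: "j \<in> {j \<in> {1..N * C}. j \<oslash> N = n}"
      then have "(j - 1) div N * N + n = (j - 1) div N * N + (j - 1) mod N + 1"
        by (auto simp: oslash_def)
      also have "\<dots> = j" using j by (simp only: div_mult_mod_eq) auto
      finally show "(j - 1) div N * N + n = j" .
    qed
    show "(\<lambda>i. i * N + n) ` {..<C} \<subseteq> {j \<in> {1..N * C}. j \<oslash> N = n}"
    proof safe
      fix i assume "i < C"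
      then have "(i + 1) * N \<le> C * N" by (intro mult_right_mono) auto
      then show "i * N + n \<in> {1..N * C}" using assms by (simp add: algebra_simps)
      have "i * N + n - 1 = (n - 1) + i * N" using assms by auto
      moreover have "((n - 1) + i * N) mod N = n - 1" using assms by (subst mod_mult_self1) auto
      ultimately have "(i * N + n - 1) mod N = n - 1" by (simp only:)
      then show "(i * N + n) \<oslash> N = n" using assms unfolding oslash_def by simp
    qed
    show "(\<lambda>j. (j - 1) div N) ` {j \<in> {1..N * C}. j \<oslash> N = n} \<subseteq> {..<C}"
      using assms by (auto simp: div_less_iff_less_mult mult.commute)
  qed
  then show ?thesis using bij_betw_same_card by fastforce
qed

text \<open>Deterministic counterpart of \<open>obs_times\<close>: the arm is read off the rank
  instead of the history, so the set does not depend on rewards.\<close>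

definition arm_times :: "nat \<Rightarrow> real \<Rightarrow> nat \<Rightarrow> nat \<Rightarrow> nat set" where
  "arm_times N w t n = {s \<in> explore N w t. card (explore N w s) \<oslash> N = n}"

lemma finite_arm_times [simp]: "finite (arm_times N w t n)"
  by (simp add: arm_times_def)

lemma card_arm_times:
  "card (arm_times N w t n) = card {j \<in> {1..card (explore N w t)}. j \<oslash> N = n}"
proof -
  note bij = bij_betw_card_explore[of N w t]
  have "(\<lambda>s. card (explore N w s)) ` arm_times N w t n
      = {j \<in> {1..card (explore N w t)}. j \<oslash> N = n}"
    unfolding arm_times_def bij_betw_imp_surj_on[OF bij, symmetric] by auto
  moreover have "inj_on (\<lambda>s. card (explore N w s)) (arm_times N w t n)"
    using bij_betw_imp_inj_on[OF bij] by (rule inj_on_subset) (auto simp: arm_times_def)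
  ultimately show ?thesis by (metis card_image)
qed

text \<open>The ranks used so far fit into \<open>\<lceil>w * ln t\<rceil>\<close> full rounds, each
  of which plays the arm once.\<close>

lemma card_arm_times_le:
  assumes "n \<in> {1..N}" "w \<ge> 0" "t \<ge> 1"
  shows "int (card (arm_times N w t n)) \<le> \<lceil>w * ln (real t)\<rceil>"
proof -
  have "w * ln (real t) \<ge> 0" using assms by simp
  then have C: "\<lceil>w * ln (real t)\<rceil> \<ge> 0" by linarith
  have "int (card (explore N w t)) \<le> int (N * nat \<lceil>w * ln (real t)\<rceil>)"
    using card_explore_le[OF assms(2,3), of N] C by simp
  then have "card (arm_times N w t n)
      \<le> card {j \<in> {1..N * nat \<lceil>w * ln (real t)\<rceil>}. j \<oslash> N = n}"
    unfolding card_arm_times of_nat_le_iff by (intro card_mono) auto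
  then show ?thesis using C unfolding card_oslash[OF assms(1)] by linarith
qed

text \<open>At an exploitation time the ranks used contain \<open>\<lceil>w * ln t\<rceil>\<close>
  full rounds.\<close>

lemma card_arm_times_ge:
  assumes "n \<in> {1..N}" "w \<ge> 0" "t > 1" "t \<notin> explore N w t"
  shows "\<lceil>w * ln (real t)\<rceil> \<le> int (card (arm_times N w t n))"
proof -
  have "w * ln (real t) \<ge> 0" using assms by simp
  then have C: "\<lceil>w * ln (real t)\<rceil> \<ge> 0" by linarith
  have "int (N * nat \<lceil>w * ln (real t)\<rceil>) \<le> int (card (explore N w t))"
    using card_explore_ge[OF assms(3,4)] C by simp
  then have "card {j \<in> {1..N * nat \<lceil>w * ln (real t)\<rceil>}. j \<oslash> N = n}
      \<le> card (arm_times N w t n)"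
    unfolding card_arm_times of_nat_le_iff by (intro card_mono) auto
  then show ?thesis using C unfolding card_oslash[OF assms(1)] by linarith
qed

section \<open>Observations gathered during exploration\<close>

lemma played_explore:
  assumes "dsee_policy N p u \<delta> w \<pi>" "t \<in> explore N w t"
  shows "played \<pi> x t = card (explore N w t) \<oslash> N"
proof -
  have "t \<ge> 1" using assms(2) explore_subset[of N w t] by auto
  moreover have "is_policy N \<pi>" using assms(1) by (simp add: dsee_policy_def)
  ultimately show ?thesis
    using assms history_of_in_space[of N \<pi> x t] unfolding dsee_policy_def played_eq[of \<pi> x t] by auto
qed

text \<open>The history covers only times before \<open>t\<close>. Since \<open>t\<close> itself is
  not explored, every exploration time up to \<open>t\<close> is recorded there, with the arm
  prescribed by its rank.\<close>

lemma obs_times_history_of: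
  assumes "dsee_policy N p u \<delta> w \<pi>" "t \<notin> explore N w t"
  shows "obs_times N w t (history_of \<pi> x t) n = arm_times N w t n"
proof -
  have "fst (history_of \<pi> x t s) = card (explore N w s) \<oslash> N" if s: "s \<in> explore N w t" for s
  proof -
    have "s \<in> {1..<t}"
      using s assms(2) explore_subset[of N w t] by (cases "s = t") auto
    moreover have "s \<in> explore N w s" using s calculation mem_explore_iff[of s t N w] by auto
    ultimately show ?thesis using played_explore[OF assms(1)] by (simp add: history_of_def)
  qed
  then show ?thesis by (auto simp: obs_times_def arm_times_def)
qed

text \<open>Each observation is the reward at a fixed, nonrandom time, so the observations of an arm
  inherit the independence of the rewards.\<close>

lemma obs_history_of:
  assumes "dsee_policy N p u \<delta> w \<pi>" "t \<notin> explore N w t" "k \<in> {1..card (arm_times N w t n)}"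
  shows "obs N w t (history_of \<pi> x t) n k = x n (sorted_list_of_set (arm_times N w t n) ! (k - 1))"
proof -
  define s where "s = sorted_list_of_set (arm_times N w t n) ! (k - 1)"
  have "s \<in> set (sorted_list_of_set (arm_times N w t n))"
    using assms(3) unfolding s_def by (intro nth_mem) auto
  then have s: "s \<in> arm_times N w t n" by simp
  then have "s \<in> {1..<t}"
    using assms(2) explore_subset[of N w t] by (cases "s = t") (auto simp: arm_times_def)
  moreover have "s \<in> explore N w s"
    using s calculation mem_explore_iff[of s t N w] by (auto simp: arm_times_def)
  ultimately have "history_of \<pi> x t s = (n, x n s)"
    using s played_explore[OF assms(1)] by (simp add: history_of_def arm_times_def)
  then show ?thesis by (simp add: obs_def obs_times_history_of[OF assms(1,2)] s_def)
qed

section \<open>Exploitation and regret\<close>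

text \<open>Injectivity of \<open>g\<close> makes the singleton blocks \<open>{g j}\<close>
  disjoint, and variables grouped into disjoint blocks are independent.\<close>

lemma (in prob_space) indep_vars_reindex:
  assumes "indep_vars M' X I" "inj_on g J" "g ` J \<subseteq> I"
  shows "indep_vars (\<lambda>j. M' (g j)) (\<lambda>j. X (g j)) J"
proof -
  have "indep_vars (\<lambda>j. PiM {g j} M') (\<lambda>j \<omega>. restrict (\<lambda>i. X i \<omega>) {g j}) J"
    using assms(2,3)
    by (intro indep_vars_restrict[OF assms(1)]) (auto simp: disjoint_family_on_def inj_on_def)
  then have "indep_vars (\<lambda>j. M' (g j)) (\<lambda>j \<omega>. (restrict (\<lambda>i. X i \<omega>) {g j}) (g j)) J"
    by (rule indep_vars_compose2) (auto intro!: measurable_component_singleton)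
  then show ?thesis by simp
qed

lemma a_const_pos: "u > 0 \<Longrightarrow> a_const p u > 0"
  by (simp add: a_const_def)

text \<open>The constant \<open>a\<close> is chosen so that the deviation bound for the truncated mean is exactly
  \<open>\<delta>\<close> at confidence level \<open>\<epsilon>\<^sub>n\<close>.\<close>

lemma deviation_eq:
  assumes "u > 0" "1 < p" "\<delta> > 0"
  shows "4 * u powr (1 / p) * (a_const p u * \<delta> powr (p / (p - 1))) powr (1 - 1 / p) = \<delta>"
proof -
  \<comment> \<open>Under the outer exponent \<open>1 - 1 / p\<close> the constant \<open>a\<close>
    becomes \<open>4 powr - 1 * u powr - (1 / p)\<close>, which cancels the prefactor, and the power
    of \<open>\<delta>\<close> becomes \<open>\<delta>\<close> itself.\<close>
  have e: "p / (1 - p) * (1 - 1 / p) = - 1" "1 / (1 - p) * (1 - 1 / p) = - (1 / p)"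
    "p / (p - 1) * (1 - 1 / p) = 1"
    using assms by (simp_all add: divide_simps)
  have "(a_const p u * \<delta> powr (p / (p - 1))) powr (1 - 1 / p)
      = 4 powr - 1 * u powr - (1 / p) * \<delta> powr 1"
    using assms unfolding a_const_def by (simp only: powr_mult powr_powr e powr_ge_zero mult_nonneg_nonneg)
  then show ?thesis using assms by (simp add: powr_minus field_simps)
qed

text \<open>A wrong choice forces some arm's truncated mean to be off by at least
  \<open>\<delta>\<close>. The union bound gives the factor \<open>N\<close>, the two tails the
  factor 2, and the lower bound on the sample sizes the power of \<open>t\<close>.\<close>

lemma (in prob_space) suboptimal_play_prob:
  fixes X :: "nat \<Rightarrow> nat \<Rightarrow> 'a \<Rightarrow> real"
  assumes indep: "indep_vars (\<lambda>_. borel) (\<lambda>(n, t). X n t) ({1..N} \<times> {1..})"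
    and int: "\<And>n t. n \<in> {1..N} \<Longrightarrow> t \<ge> 1 \<Longrightarrow> integrable M (X n t)"
      "\<And>n t. n \<in> {1..N} \<Longrightarrow> t \<ge> 1 \<Longrightarrow> integrable M (\<lambda>\<omega>. \<bar>X n t \<omega>\<bar> powr p)"
    and mean: "\<And>n t. n \<in> {1..N} \<Longrightarrow> t \<ge> 1 \<Longrightarrow> expectation (X n t) = \<theta> n"
    and moment: "\<And>n t. n \<in> {1..N} \<Longrightarrow> t \<ge> 1 \<Longrightarrow> expectation (\<lambda>\<omega>. \<bar>X n t \<omega>\<bar> powr p) \<le> u"
    and u: "u > 0" and p: "1 < p" "p \<le> 2" and \<delta>: "\<delta> > 0" and w: "w > 0"
    and b: "b \<in> {1..N}" and gap: "\<And>n. n \<in> {1..N} \<Longrightarrow> n \<noteq> b \<Longrightarrow> \<theta> b - \<theta> n > 2 * \<delta>"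
    and dsee: "dsee_policy N p u \<delta> w \<pi>" and t: "t \<ge> 1" "t \<notin> explore N w t"
  shows "prob {\<omega> \<in> space M. played \<pi> (\<lambda>n s. X n s \<omega>) t \<noteq> b}
      \<le> 2 * real N * real t powr - (a_const p u * \<delta> powr (p / (p - 1)) * w)"
\<comment> \<open>At time 1 nothing has been observed, but the bound is \<open>2 * N\<close>, which
  exceeds every probability.\<close>
proof (cases "t = 1")
  case True
  have "prob {\<omega> \<in> space M. played \<pi> (\<lambda>n s. X n s \<omega>) t \<noteq> b} \<le> 1" by (rule prob_le_1)
  also have "1 \<le> 2 * real N" using b by simp
  finally show ?thesis using True by simp
next
  case False
  then have t1: "t > 1" using t by simp
  define c where "c = a_const p u * \<delta> powr (p / (p - 1))"
  have c: "c > 0" using a_const_pos[OF u] \<delta> by (simp add: c_def)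
  define \<tau> where "\<tau> = (\<lambda>n. card (arm_times N w t n))"
  \<comment> \<open>\<open>e n k\<close> is the time of the k-th observation of arm
    \<open>n\<close>; list positions start at 0, hence \<open>k - 1\<close>.\<close>
  define e where "e = (\<lambda>n k. sorted_list_of_set (arm_times N w t n) ! (k - 1))"
  define Z where "Z = (\<lambda>n k. X n (e n k))"
  define \<mu> where "\<mu> = (\<lambda>n \<omega>. trunc_mean p u (\<lambda>k. Z n k \<omega>) (\<tau> n) (eps p u \<delta> (\<tau> n)))"
  define bad where "bad = (\<lambda>n. {\<omega> \<in> space M. \<bar>\<mu> n \<omega> - \<theta> n\<bar> \<ge> \<delta>})"
  have e_mem: "e n k \<in> arm_times N w t n" if "k \<in> {1..\<tau> n}" for n k
  proof -
    have "e n k \<in> set (sorted_list_of_set (arm_times N w t n))"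
      using that unfolding e_def \<tau>_def by (intro nth_mem) auto
    then show ?thesis by simp
  qed
  have e1: "e n k \<ge> 1" if "k \<in> {1..\<tau> n}" for n k
    using e_mem[OF that] explore_subset[of N w t] by (auto simp: arm_times_def)
  have e_inj: "inj_on (e n) {1..\<tau> n}" for n
  proof (rule inj_onI)
    fix k l assume "k \<in> {1..\<tau> n}" "l \<in> {1..\<tau> n}" "e n k = e n l"
    then have "k - 1 = l - 1"
      unfolding e_def \<tau>_def
      by (subst nth_eq_iff_index_eq[of "sorted_list_of_set (arm_times N w t n)", symmetric]) auto
    then show "k = l" using \<open>k \<in> {1..\<tau> n}\<close> \<open>l \<in> {1..\<tau> n}\<close> by auto
  qed
  have \<tau>_ge: "real (\<tau> n) \<ge> w * ln (real t)" if "n \<in> {1..N}" for n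
    using card_arm_times_ge[OF that _ t1 t(2)] w unfolding \<tau>_def by linarith
  have \<tau>_pos: "\<tau> n > 0" if "n \<in> {1..N}" for n
  proof -
    have "w * ln (real t) > 0" using w t1 by simp
    then show ?thesis using \<tau>_ge[OF that] by linarith
  qed
  have indepZ: "indep_vars (\<lambda>_. borel) (Z n) {1..\<tau> n}" if n: "n \<in> {1..N}" for n
  proof -
    have "inj_on (\<lambda>k. (n, e n k)) {1..\<tau> n}"
      using e_inj[of n] unfolding inj_on_def by blast
    moreover have "(\<lambda>k. (n, e n k)) ` {1..\<tau> n} \<subseteq> {1..N} \<times> {1..}"
      using e1 n by auto
    ultimately show ?thesis
      using indep_vars_reindex[OF indep, of "\<lambda>k. (n, e n k)" "{1..\<tau> n}"] by (simp add: Z_def)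
  qed
  have eps: "eps p u \<delta> (\<tau> n) = exp (- (c * real (\<tau> n)))" for n
    by (simp add: eps_def c_def)
  have bad_prob: "prob (bad n) \<le> 2 * real t powr - (c * w)" if n: "n \<in> {1..N}" for n
  proof -
    \<comment> \<open>\<open>ln (inverse \<epsilon>) / \<tau>\<close> is the constant
      \<open>c\<close> whatever the sample size, so the deviation threshold is always
      \<open>\<delta>\<close>.\<close>
    have thr: "4 * u powr (1 / p) * (ln (inverse (eps p u \<delta> (\<tau> n))) / real (\<tau> n)) powr (1 - 1 / p) = \<delta>"
      using \<tau>_pos[OF n] deviation_eq[OF u p(1) \<delta>] by (simp add: eps ln_inverse c_def)
    have "prob {\<omega> \<in> space M. \<bar>trunc_mean p u (\<lambda>k. Z n k \<omega>) (\<tau> n) (eps p u \<delta> (\<tau> n)) - \<theta> n\<bar>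
           \<ge> 4 * u powr (1 / p) * (ln (inverse (eps p u \<delta> (\<tau> n))) / real (\<tau> n)) powr (1 - 1 / p)}
         \<le> 2 * eps p u \<delta> (\<tau> n)"
    proof (rule trunc_mean_deviation)
      show "eps p u \<delta> (\<tau> n) < 1" using c \<tau>_pos[OF n] by (simp add: eps)
    qed (use n u p indepZ e1 \<tau>_pos in \<open>auto simp: Z_def eps int mean moment\<close>)
    then have "prob (bad n) \<le> 2 * exp (- (c * real (\<tau> n)))"
      unfolding thr by (simp add: bad_def \<mu>_def eps)
    also have "\<dots> \<le> 2 * exp (- (c * (w * ln (real t))))"
      using \<tau>_ge[OF n] c by simp
    also have "\<dots> = 2 * real t powr - (c * w)"
      using t1 by (simp add: powr_def mult.assoc)
    finally show ?thesis .
  qed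
  have bad_event: "bad n \<in> events" if n: "n \<in> {1..N}" for n
  proof -
    have [measurable]: "random_variable borel (Z n k)" if "k \<in> {1..\<tau> n}" for k
      using indepZ[OF n] that by (auto simp: indep_vars_def)
    show ?thesis unfolding bad_def \<mu>_def trunc_mean_def by measurable
  qed
  have "{\<omega> \<in> space M. played \<pi> (\<lambda>n s. X n s \<omega>) t \<noteq> b} \<subseteq> (\<Union>n\<in>{1..N}. bad n)"
  proof (rule subsetI, rule ccontr)
    fix \<omega> assume "\<omega> \<in> {\<omega> \<in> space M. played \<pi> (\<lambda>n s. X n s \<omega>) t \<noteq> b}"
      and nbad: "\<omega> \<notin> (\<Union>n\<in>{1..N}. bad n)"
    define x where "x = (\<lambda>n s. X n s \<omega>)"
    define m where "m = played \<pi> x t"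
    have \<pi>: "is_policy N \<pi>" using dsee by (simp add: dsee_policy_def)
    have m: "m \<in> {1..N}" unfolding m_def by (rule played_in_arms[OF \<pi> t(1)])
    have mb: "m \<noteq> b" and \<omega>: "\<omega> \<in> space M"
      using \<open>\<omega> \<in> {\<omega> \<in> space M. played \<pi> (\<lambda>n s. X n s \<omega>) t \<noteq> b}\<close> by (auto simp: m_def x_def)
    define h where "h = history_of \<pi> x t"
    have "h \<in> space (history_space N t)"
      unfolding h_def by (rule history_of_in_space[OF \<pi>])
    note dsee[unfolded dsee_policy_def, THEN conjunct2, THEN spec, THEN mp, OF t(1), THEN bspec, OF this]
    then obtain v where v: "\<forall>n\<in>{1..N}. obs_count N w t h n > 0 \<longrightarrow>
          v n = trunc_mean p u (obs N w t h n) (obs_count N w t h n)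
                  (eps p u \<delta> (obs_count N w t h n))"
        and arg: "is_arg_max v (\<lambda>n. n \<in> {1..N}) m"
      unfolding m_def played_eq[of \<pi> x t] h_def[symmetric] if_not_P[OF t(2)] by blast
    have close: "\<bar>v n - \<theta> n\<bar> < \<delta>" if n: "n \<in> {1..N}" for n
    proof -
      have count: "obs_count N w t h n = \<tau> n"
        by (simp add: h_def obs_count_def obs_times_history_of[OF dsee t(2)] \<tau>_def)
      have "v n = trunc_mean p u (obs N w t h n) (\<tau> n) (eps p u \<delta> (\<tau> n))"
        using v[THEN bspec, OF n] \<tau>_pos[OF n] unfolding count by simp
      also have "\<dots> = \<mu> n \<omega>"
        unfolding \<mu>_def
        by (rule trunc_mean_cong) (simp add: h_def obs_history_of[OF dsee t(2)] Z_def e_def x_def \<tau>_def)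
      finally have "v n = \<mu> n \<omega>" .
      then show ?thesis using nbad n \<omega> by (auto simp: bad_def not_le)
    qed
    \<comment> \<open>Maximality contradicts
      \<open>v m < \<theta> m + \<delta> < \<theta> b - \<delta> < v b\<close>.\<close>
    have "v b \<le> v m" using arg b by (auto simp: is_arg_max_def not_less)
    then show False using close[OF b] close[OF m] gap[OF m mb] by linarith
  qed
  then have "prob {\<omega> \<in> space M. played \<pi> (\<lambda>n s. X n s \<omega>) t \<noteq> b} \<le> prob (\<Union>n\<in>{1..N}. bad n)"
    using bad_event by (intro finite_measure_mono) auto
  also have "\<dots> \<le> (\<Sum>n\<in>{1..N}. prob (bad n))"
    using bad_event by (intro measure_UNION_le) auto
  also have "\<dots> \<le> (\<Sum>n\<in>{1..N}. 2 * real t powr - (c * w))"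
    using bad_prob by (intro sum_mono) auto
  finally show ?thesis by (simp add: c_def algebra_simps)
qed

section \<open>Summation of the regret over exploration and exploitation\<close>

theorem theorem4:
  fixes M :: "'w measure"
    and X :: "nat \<Rightarrow> nat \<Rightarrow> 'w \<Rightarrow> real"
    and f :: "nat \<Rightarrow> real measure"
    and \<sigma> :: "nat \<Rightarrow> nat"
    and \<pi> :: policy
    and N T :: nat
    and u p \<delta> w :: real
  assumes "prob_space M"
    and "N \<ge> 2"
    and "prob_space.indep_vars M (\<lambda>_. borel) (\<lambda>(n, t). X n t) ({1..N} \<times> {1..})"
    and "\<And>n t. n \<in> {1..N} \<Longrightarrow> t \<ge> 1 \<Longrightarrow> distr M borel (X n t) = f n"
    and "\<And>n. n \<in> {1..N} \<Longrightarrow> integrable M (X n 1)"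
    and "\<sigma> permutes {1..N}"
    and "\<And>i j. 1 \<le> i \<Longrightarrow> i \<le> j \<Longrightarrow> j \<le> N \<Longrightarrow>
           arm_mean M X (\<sigma> i) \<ge> arm_mean M X (\<sigma> j)"
    and "u > 0"
    and "1 < p" and "p \<le> 2"
    and "\<And>n. n \<in> {1..N} \<Longrightarrow> (\<integral>\<^sup>+\<omega>. ennreal (\<bar>X n 1 \<omega>\<bar> powr p) \<partial>M) \<le> ennreal u"
    and "0 < \<delta>" and "\<delta> < gap M X \<sigma> 2 / 2"
    and "w > 1 / (a_const p u * \<delta> powr (p / (p - 1)))"
    and "dsee_policy N p u \<delta> w \<pi>"
    and "T \<ge> 1"
  shows "regret M X \<sigma> \<pi> T \<le>
           (\<Sum>n=2..N. real_of_int \<lceil>w * ln (real T)\<rceil> * gap M X \<sigma> n)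
           + 2 * real N * gap M X \<sigma> N
               * (1 + 1 / (a_const p u * \<delta> powr (p / (p - 1)) * w - 1))"
proof -
  interpret prob_space M by fact
  note N = \<open>N \<ge> 2\<close> and indep = assms(3) and \<sigma> = \<open>\<sigma> permutes {1..N}\<close> and sorted = assms(7)
    and dsee = \<open>dsee_policy N p u \<delta> w \<pi>\<close>
  have \<pi>: "is_policy N \<pi>" using dsee by (simp add: dsee_policy_def)
  define \<theta> where "\<theta> = arm_mean M X"
  \<comment> \<open>\<open>gap\<close> is indexed by rank under \<open>\<sigma>\<close>,
    \<open>g\<close> by the arm itself.\<close>
  define g where "g = (\<lambda>n. \<theta> (\<sigma> 1) - \<theta> n)"
  define c where "c = a_const p u * \<delta> powr (p / (p - 1))"
  define P where "P = (\<lambda>t n. prob {\<omega> \<in> space M. played \<pi> (\<lambda>m s. X m s \<omega>) t = n})"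
  have c: "c > 0" using a_const_pos[OF \<open>u > 0\<close>] \<open>0 < \<delta>\<close> by (simp add: c_def)
  have "w > 1 / c" using assms(14) by (simp add: c_def)
  moreover have "1 / c > 0" using c by simp
  ultimately have w: "w > 0" and cw: "c * w > 1"
    using c by (linarith, simp add: field_simps)
  have rv: "random_variable borel (X n t)" if "n \<in> {1..N}" "t \<ge> 1" for n t
    using indep that unfolding indep_vars_def by (auto dest!: bspec[where x="(n, t)"])
  \<comment> \<open>The mean and moment hypotheses concern time 1 only; equality of distributions
    carries them to every time.\<close>
  have same_distr: "distr M borel (X n t) = distr M borel (X n 1)" if "n \<in> {1..N}" "t \<ge> 1" for n t
    using assms(4) that by simp
  have int: "integrable M (X n t)" if "n \<in> {1..N}" "t \<ge> 1" for n t
  proof -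
    have "integrable (distr M borel (X n 1)) (\<lambda>x. x)"
      using assms(5)[OF that(1)] rv[of n 1] that by (simp add: integrable_distr_eq)
    then show ?thesis
      using rv[OF that] unfolding same_distr[OF that, symmetric] by (simp add: integrable_distr_eq)
  qed
  have mean: "expectation (X n t) = \<theta> n" if "n \<in> {1..N}" "t \<ge> 1" for n t
  proof -
    have "expectation (X n t) = (\<integral>x. x \<partial>distr M borel (X n t))"
      using rv[OF that] by (simp add: integral_distr)
    also have "\<dots> = expectation (X n 1)"
      using rv[of n 1] that(1) unfolding same_distr[OF that] by (simp add: integral_distr)
    finally show ?thesis by (simp add: \<theta>_def arm_mean_def)
  qed
  have nn_moment: "(\<integral>\<^sup>+\<omega>. ennreal (\<bar>X n t \<omega>\<bar> powr p) \<partial>M) \<le> ennreal u"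
    if "n \<in> {1..N}" "t \<ge> 1" for n t
  proof -
    have "(\<integral>\<^sup>+\<omega>. ennreal (\<bar>X n t \<omega>\<bar> powr p) \<partial>M)
        = (\<integral>\<^sup>+x. ennreal (\<bar>x\<bar> powr p) \<partial>distr M borel (X n t))"
      using rv[OF that] by (simp add: nn_integral_distr)
    also have "\<dots> = (\<integral>\<^sup>+\<omega>. ennreal (\<bar>X n 1 \<omega>\<bar> powr p) \<partial>M)"
      using rv[of n 1] that(1) unfolding same_distr[OF that] by (simp add: nn_integral_distr)
    finally show ?thesis using assms(11)[OF that(1)] by simp
  qed
  have int_moment: "integrable M (\<lambda>\<omega>. \<bar>X n t \<omega>\<bar> powr p)" if "n \<in> {1..N}" "t \<ge> 1" for n t
    using rv[OF that] nn_moment[OF that]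
    by (intro integrableI_nonneg) (auto intro: le_less_trans[OF _ ennreal_less_top])
  have moment: "expectation (\<lambda>\<omega>. \<bar>X n t \<omega>\<bar> powr p) \<le> u" if "n \<in> {1..N}" "t \<ge> 1" for n t
    using nn_moment[OF that] int_moment[OF that] \<open>u > 0\<close>
    by (simp add: nn_integral_eq_integral)
  have \<sigma>1: "\<sigma> 1 \<in> {1..N}" using permutes_in_image[OF \<sigma>, of 1] N by simp
  have arm: "\<exists>m\<in>{1..N}. n = \<sigma> m" if "n \<in> {1..N}" for n
    using permutes_image[OF \<sigma>] that by blast
  have g: "g (\<sigma> m) = gap M X \<sigma> m" for m
    by (simp add: g_def gap_def \<theta>_def)
  have g_nonneg: "g n \<ge> 0" and g_le: "g n \<le> gap M X \<sigma> N" if "n \<in> {1..N}" for n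
    using arm[OF that] sorted[of 1] sorted[of _ N] by (auto simp: g_def \<theta>_def gap_def)
  have gap_best: "\<theta> (\<sigma> 1) - \<theta> n > 2 * \<delta>" if n: "n \<in> {1..N}" "n \<noteq> \<sigma> 1" for n
  proof -
    obtain m where m: "m \<in> {1..N}" "n = \<sigma> m" using arm[OF n(1)] by blast
    with n(2) have "2 \<le> m" by (cases "m = 1") auto
    then show ?thesis using sorted[of 2 m] m \<open>\<delta> < gap M X \<sigma> 2 / 2\<close> by (simp add: \<theta>_def gap_def)
  qed
  have P_meas[measurable]: "(\<lambda>\<omega>. played \<pi> (\<lambda>m s. X m s \<omega>) t) \<in> measurable M (count_space {1..N})"
    if "t \<ge> 1" for t
    using that rv by (intro measurable_played[OF \<pi>]) auto
  have P_event: "{\<omega> \<in> space M. played \<pi> (\<lambda>m s. X m s \<omega>) t = n} \<in> events" if "t \<ge> 1" for t n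
    using P_meas[OF that] by measurable
  have P_sum: "(\<Sum>n=1..N. P t n) = 1" if t: "t \<ge> 1" for t
  proof -
    have "(\<Sum>n=1..N. P t n) = prob (\<Union>n\<in>{1..N}. {\<omega> \<in> space M. played \<pi> (\<lambda>m s. X m s \<omega>) t = n})"
      unfolding P_def using P_event[OF t]
      by (intro finite_measure_finite_Union[symmetric]) (auto simp: disjoint_family_on_def)
    also have "(\<Union>n\<in>{1..N}. {\<omega> \<in> space M. played \<pi> (\<lambda>m s. X m s \<omega>) t = n}) = space M"
      using played_in_arms[OF \<pi> t] by auto
    finally show ?thesis by (simp add: prob_space)
  qed
  \<comment> \<open>\<open>r t\<close> is the expected loss at time \<open>t\<close>; because the
    play probabilities add up to 1, the regret is the sum of these losses.\<close>
  define r where "r = (\<lambda>t. \<Sum>n=1..N. P t n * g n)"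
  have reward: "integrable M (\<lambda>\<omega>. X (played \<pi> (\<lambda>n s. X n s \<omega>) t) t \<omega>)"
      "expectation (\<lambda>\<omega>. X (played \<pi> (\<lambda>n s. X n s \<omega>) t) t \<omega>) = (\<Sum>n=1..N. P t n * \<theta> n)"
    if "t \<in> {1..T}" for t
    using that expected_reward[OF indep \<pi> _ int, of t] mean[of _ t] by (simp_all add: P_def)
  have "regret M X \<sigma> \<pi> T = (\<Sum>t=1..T. \<theta> (\<sigma> 1) - (\<Sum>n=1..N. P t n * \<theta> n))"
    unfolding regret_def \<theta>_def[symmetric] sum_subtractf
    by (subst Bochner_Integration.integral_sum) (use reward in simp_all)
  also have "\<dots> = (\<Sum>t=1..T. r t)"
  proof (rule sum.cong)
    fix t assume "t \<in> {1..T}"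
    then have "\<theta> (\<sigma> 1) = (\<Sum>n=1..N. P t n * \<theta> (\<sigma> 1))"
      using P_sum[of t] by (simp flip: sum_distrib_right)
    then show "\<theta> (\<sigma> 1) - (\<Sum>n=1..N. P t n * \<theta> n) = r t"
      by (simp add: r_def g_def right_diff_distrib sum_subtractf)
  qed simp
  also have "\<dots> = (\<Sum>t\<in>explore N w T. r t) + (\<Sum>t\<in>{1..T} - explore N w T. r t)"
    using explore_subset[of N w T] by (subst sum.subset_diff[of "explore N w T"]) auto
  also have "\<dots> \<le> (\<Sum>n=2..N. real_of_int \<lceil>w * ln (real T)\<rceil> * gap M X \<sigma> n)
      + 2 * real N * gap M X \<sigma> N * (1 + 1 / (c * w - 1))"
  proof (rule add_mono)
    let ?C = "real_of_int \<lceil>w * ln (real T)\<rceil>"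
    have "(\<Sum>t\<in>explore N w T. r t) = (\<Sum>t\<in>explore N w T. g (card (explore N w t) \<oslash> N))"
    proof (rule sum.cong)
      fix t assume t: "t \<in> explore N w T"
      then have "t \<in> explore N w t" "t \<ge> 1"
        using explore_subset[of N w T] mem_explore_iff[of t T N w] by auto
      \<comment> \<open>At exploration times the arm is deterministic, so its distribution is a
        point mass.\<close>
      then have "P t n = of_bool (n = card (explore N w t) \<oslash> N)" for n
        using played_explore[OF dsee, of t] by (auto simp: P_def prob_space)
      moreover have "card (explore N w t) \<oslash> N \<in> {1..N}"
        using N by (simp add: oslash_def Suc_le_eq)
      ultimately show "r t = g (card (explore N w t) \<oslash> N)"
        by (simp add: r_def sum.remove[of "{1..N}" "card (explore N w t) \<oslash> N"])
    qed simp
    also have "\<dots> = (\<Sum>n\<in>{1..N}. \<Sum>t\<in>arm_times N w T n. g (card (explore N w t) \<oslash> N))"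
      unfolding arm_times_def
      using N by (intro sum.group[symmetric]) (auto simp: oslash_def Suc_le_eq)
    also have "\<dots> = (\<Sum>n\<in>{1..N}. real (card (arm_times N w T n)) * g n)"
      by (simp add: arm_times_def)
    also have "\<dots> \<le> (\<Sum>n\<in>{1..N}. ?C * g n)"
    proof (intro sum_mono mult_right_mono g_nonneg)
      fix n assume "n \<in> {1..N}"
      then show "real (card (arm_times N w T n)) \<le> ?C"
        using card_arm_times_le[of n N w T] w \<open>T \<ge> 1\<close> by linarith
    qed
    \<comment> \<open>Summing by rank instead of by arm isolates the best arm, whose gap is 0, so
      the sum may start at rank 2.\<close>
    also have "\<dots> = (\<Sum>m\<in>{1..N}. ?C * g (\<sigma> m))"
      by (subst sum.permute[OF \<sigma>]) (simp add: o_def)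
    also have "\<dots> = (\<Sum>m=2..N. ?C * gap M X \<sigma> m)"
      unfolding g using N by (subst sum.atLeast_Suc_atMost) (auto simp: gap_def numeral_2_eq_2)
    finally show "(\<Sum>t\<in>explore N w T. r t) \<le> (\<Sum>n=2..N. ?C * gap M X \<sigma> n)" .
  next
    have r_le: "r t \<le> gap M X \<sigma> N * (2 * real N * real t powr - (c * w))"
      if t: "t \<in> {1..T} - explore N w T" for t
    proof -
      have t': "t \<ge> 1" "t \<notin> explore N w t" using t mem_explore_iff[of t T N w] by auto
      \<comment> \<open>The best arm costs nothing and every other arm at most the largest gap, so
        the loss is at most that gap times the probability of a wrong choice.\<close>
      have "r t = (\<Sum>n\<in>{1..N} - {\<sigma> 1}. P t n * g n)"
        unfolding r_def using \<sigma>1 by (subst sum.remove[of _ "\<sigma> 1"]) (auto simp: g_def)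
      also have "\<dots> \<le> (\<Sum>n\<in>{1..N} - {\<sigma> 1}. P t n * gap M X \<sigma> N)"
        using g_le by (intro sum_mono mult_left_mono) (auto simp: P_def)
      also have "\<dots> = (\<Sum>n\<in>{1..N} - {\<sigma> 1}. P t n) * gap M X \<sigma> N"
        by (rule sum_distrib_right[symmetric])
      also have "(\<Sum>n\<in>{1..N} - {\<sigma> 1}. P t n) = 1 - P t (\<sigma> 1)"
        using P_sum[OF t'(1)] sum.remove[OF _ \<sigma>1, of "P t"] by simp
      also have "1 - P t (\<sigma> 1) = prob {\<omega> \<in> space M. played \<pi> (\<lambda>m s. X m s \<omega>) t \<noteq> \<sigma> 1}"
        unfolding P_def using P_event[OF t'(1)] by (subst prob_neg) auto
      also have "prob {\<omega> \<in> space M. played \<pi> (\<lambda>m s. X m s \<omega>) t \<noteq> \<sigma> 1} * gap M X \<sigma> N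
          \<le> 2 * real N * real t powr - (c * w) * gap M X \<sigma> N"
        unfolding c_def
        using g_nonneg[of "\<sigma> N"] permutes_in_image[OF \<sigma>, of N] N
        by (intro mult_right_mono suboptimal_play_prob[OF indep int int_moment mean moment])
          (use assms w \<sigma>1 gap_best t' in \<open>auto simp: g\<close>)
      finally show ?thesis by (simp add: mult_ac)
    qed
    have gN: "gap M X \<sigma> N \<ge> 0"
      using g_nonneg[of "\<sigma> N"] permutes_in_image[OF \<sigma>, of N] N by (simp add: g)
    have "(\<Sum>t\<in>{1..T} - explore N w T. r t)
        \<le> (\<Sum>t\<in>{1..T} - explore N w T. gap M X \<sigma> N * (2 * real N * real t powr - (c * w)))"
      by (intro sum_mono r_le)
    \<comment> \<open>The terms are nonnegative, so adding the exploration times back only enlarges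
      the sum and leaves a power sum with exponent \<open>c * w > 1\<close>.\<close>
    also have "\<dots> \<le> (\<Sum>t=1..T. gap M X \<sigma> N * (2 * real N * real t powr - (c * w)))"
      using gN by (intro sum_mono2) auto
    also have "\<dots> = 2 * real N * gap M X \<sigma> N * (\<Sum>t=1..T. real t powr - (c * w))"
      by (simp add: sum_distrib_left mult_ac)
    also have "\<dots> \<le> 2 * real N * gap M X \<sigma> N * (1 + 1 / (c * w - 1))"
      using gN cw \<open>T \<ge> 1\<close> by (intro mult_left_mono sum_powr_neg_le) auto
    finally show "(\<Sum>t\<in>{1..T} - explore N w T. r t)
        \<le> 2 * real N * gap M X \<sigma> N * (1 + 1 / (c * w - 1))" .
  qed
  finally show ?thesis by (simp add: c_def)
qed

end
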